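(* Let $q$ be a prime power, $d=2$ and $n=4$, and let $C=C_{q,4,2}$. If $q\equiv 3 \pmod 5$ then $\#C(\mathbb{F}_{q^n}) = 1+q^{n-1+d}+4(q-1)q^{n-1}$, and otherwise $\#C(\mathbb{F}_{q^n}) = 1+q^{n-1+d}$.
   Context: Let $q=p^r$ be a prime power, let $n\ge 4$ be an integer and let $d$ be a divisor of $n$ with $1<d<n$. Put $R_d(x)=x+x^q+x^{q^2}+\cdots+x^{q^{d-2}}+x^{q^{d-1}+q^d-1}$ (so $R_2(x)=x+x^{q^2+q-1}$). The curve $C=C_{q,n,d}$ is the projective plane curve over $\mathbb{F}_q$ defined by the homogenization of the affine equation $y+y^q+y^{q^2}+\cdots+y^{q^{n-1}}=R_d(x)$. $C(\mathbb{F}_{q^n})$ denotes the set of $\mathbb{F}_{q^n}$-rational points of this projective plane curve (including points at infinity). *)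

theory Defs
  imports
    "HOL-Library.Cardinality"
    "HOL-Computational_Algebra.Polynomial"
    "HOL-Number_Theory.Cong"
    "HOL-Number_Theory.Prime_Powers"
begin

text \<open>
  A polynomial \<open>P\<close> of type \<open>'a poly poly\<close> is read as a polynomial in \<open>y\<close> with coefficients in
  \<open>k[x]\<close>: the coefficient of \<open>x^i y^j\<close> is \<open>coeff (coeff P j) i\<close>. Similarly \<open>'a poly poly poly\<close>
  is read as \<open>k[x][y][z]\<close>.
\<close>

definition total_degree :: "'a::zero poly poly \<Rightarrow> nat" where
  "total_degree P = Max (insert 0 {i + j |i j. coeff (coeff P j) i \<noteq> 0})"

definition homogenize :: "'a::comm_ring_1 poly poly \<Rightarrow> 'a poly poly poly" where
  "homogenize P = (\<Sum>j\<le>degree P. \<Sum>i\<le>degree (coeff P j).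
     monom (monom (monom (coeff (coeff P j) i) i) j) (total_degree P - (i + j)))"

definition eval3 :: "'a::comm_ring_1 poly poly poly \<Rightarrow> 'a \<times> 'a \<times> 'a \<Rightarrow> 'a" where
  "eval3 F = (\<lambda>(x, y, z). poly (poly (poly F [:[:z:]:]) [:y:]) x)"

definition proj_rel :: "(('a::field \<times> 'a \<times> 'a) \<times> ('a \<times> 'a \<times> 'a)) set" where
  "proj_rel = {((x, y, z), (x', y', z')).
     (x, y, z) \<noteq> (0, 0, 0) \<and> (\<exists>c. c \<noteq> 0 \<and> x' = c * x \<and> y' = c * y \<and> z' = c * z)}"

definition proj_plane :: "('a::field \<times> 'a \<times> 'a) set set" where
  "proj_plane = (UNIV - {(0, 0, 0)}) // proj_rel"

definition rational_points :: "'a::field poly poly poly \<Rightarrow> ('a \<times> 'a \<times> 'a) set set" where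
  "rational_points F = {Q \<in> proj_plane. \<forall>v\<in>Q. eval3 F v = 0}"

text \<open>For \<open>d \<ge> 1\<close> the sum is \<open>x + x^q + \<dots> + x^(q^(d-2))\<close>.\<close>

definition R_poly :: "nat \<Rightarrow> nat \<Rightarrow> 'a::comm_ring_1 poly" where
  "R_poly q d = (\<Sum>i<d - 1. monom 1 (q ^ i)) + monom 1 (q ^ (d - 1) + q ^ d - 1)"

text \<open>
  The coefficients of the following polynomials lie in the image of the integers, so over a field of
  order \<open>q^n\<close> they define a curve over the subfield of order \<open>q\<close>.
\<close>

definition affine_eqn :: "nat \<Rightarrow> nat \<Rightarrow> nat \<Rightarrow> 'a::comm_ring_1 poly poly" where
  "affine_eqn q n d = (\<Sum>j<n. monom 1 (q ^ j)) - [:R_poly q d:]"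

definition curve_C :: "nat \<Rightarrow> nat \<Rightarrow> nat \<Rightarrow> 'a::comm_ring_1 poly poly poly" where
  "curve_C q n d = homogenize (affine_eqn q n d)"

end

theory Submission
  imports Defs
begin

text \<open>
  Write \<open>K\<close> for the field of order \<open>q^4\<close>, \<open>F\<close> for its subfield of order \<open>q\<close>, and let
  \<open>R x = x + x^(q^2 + q - 1)\<close>. The left-hand side of the affine equation is the trace of \<open>K\<close> over
  \<open>F\<close>, of degree \<open>q^3\<close>, which exceeds the degree of \<open>R\<close>. Hence \<open>(1 : 0 : 0)\<close> is the only point at
  infinity. The trace maps \<open>K\<close> onto \<open>F\<close> with fibres of size \<open>q^3\<close>, so there are \<open>q^3\<close> affine points
  above each \<open>x\<close> with \<open>R x \<in> F\<close> and none above any other \<open>x\<close>. It remains to count these \<open>x\<close>.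

  Let \<open>a = x\<close>, \<open>b = x^q\<close>, \<open>c = x^(q^2)\<close>, \<open>d = x^(q^3)\<close>, and suppose that \<open>r = R x\<close> lies in \<open>F\<close>. Then
  \<open>a^2 + b c = r a\<close>, and applying the Frobenius map gives the three cyclic shifts of this equation.
  If \<open>r\<close> is nonzero, the system forces \<open>a = c\<close>, that is, \<open>x\<close> lies in the subfield of order \<open>q^2\<close>
  (lemma \<open>cyclic_quadratic_system\<close>). If \<open>r = 0\<close> and \<open>x\<close> is nonzero, then \<open>v = - x^(q - 1)\<close> satisfies
  \<open>v^q v^2 = 1\<close>; because \<open>-v\<close> has norm 1 this amounts to \<open>v^5 = 1\<close> and \<open>v^q = v^3\<close>
  (lemma \<open>R2_eq_0_iff\<close>). For \<open>v = 1\<close> again \<open>x^(q^2) = x\<close>. A primitive fifth root of unity \<open>v\<close>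
  with \<open>v^q = v^3\<close> exists exactly when \<open>q\<close> is 3 modulo 5; then there are four of them, and for each
  one \<open>x^(q - 1) = -v\<close> has \<open>q - 1\<close> solutions by Hilbert's Theorem 90. Conversely, every \<open>x\<close> with
  \<open>x^(q^2) = x\<close> has \<open>R x \<in> F\<close>. So the number of \<open>x\<close> is \<open>q^2\<close>, plus \<open>4 (q - 1)\<close> if \<open>q\<close> is 3
  modulo 5.

  All sizes of fibres, subfields and groups of roots of unity come from one principle
  (lemma \<open>card_fibre_extremal\<close>): the number of roots of a polynomial bounds both the fibres and the
  image of a map, and the cardinality of \<open>K\<close> leaves no room for strict inequality in either bound.
\<close>

section \<open>Projective points\<close>

lemma equiv_proj_rel: "equiv (UNIV - {(0, 0, 0)}) (proj_rel :: (('a::field \<times> 'a \<times> 'a) \<times> _) set)"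
proof (rule equivI)
  show "proj_rel \<subseteq> (UNIV - {(0, 0, 0)}) \<times> (UNIV - {(0, 0, 0 :: 'a)})"
    by (auto simp: proj_rel_def)
  show "refl_on (UNIV - {(0, 0, 0)}) (proj_rel :: (('a \<times> 'a \<times> 'a) \<times> _) set)"
    unfolding refl_on_def proj_rel_def by (auto intro: exI[of _ 1])
  show "sym (proj_rel :: (('a \<times> 'a \<times> 'a) \<times> _) set)"
  proof (rule symI)
    fix u v :: "'a \<times> 'a \<times> 'a"
    assume "(u, v) \<in> proj_rel"
    then obtain x y z c where "u = (x, y, z)" "v = (c * x, c * y, c * z)" "c \<noteq> 0"
      "(x, y, z) \<noteq> (0, 0, 0)"
      by (auto simp: proj_rel_def)
    then show "(v, u) \<in> proj_rel"
      unfolding proj_rel_def by (auto intro!: exI[of _ "inverse c"])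
  qed
  show "trans (proj_rel :: (('a \<times> 'a \<times> 'a) \<times> _) set)"
  proof (rule transI)
    fix u v w :: "'a \<times> 'a \<times> 'a"
    assume uv: "(u, v) \<in> proj_rel" and vw: "(v, w) \<in> proj_rel"
    from uv obtain x y z c where u: "u = (x, y, z)" "(x, y, z) \<noteq> (0, 0, 0)"
      and v: "v = (c * x, c * y, c * z)" "c \<noteq> 0"
      by (auto simp: proj_rel_def)
    from vw v obtain c' where "w = (c' * (c * x), c' * (c * y), c' * (c * z))" "c' \<noteq> 0"
      by (auto simp: proj_rel_def)
    with u v have "u = (x, y, z)" "w = (c' * (c * x), c' * (c * y), c' * (c * z))"
      "c \<noteq> 0" "c' \<noteq> 0" "(x, y, z) \<noteq> (0, 0, 0)"
      by simp_all
    then show "(u, w) \<in> proj_rel"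
      unfolding proj_rel_def by (auto intro!: exI[of _ "c' * c"])
  qed
qed

lemma eval3_homogenize:
  "eval3 (homogenize P) (x, y, z) =
     (\<Sum>j\<le>degree P. \<Sum>i\<le>degree (coeff P j).
        coeff (coeff P j) i * x ^ i * y ^ j * z ^ (total_degree P - (i + j)))"
  by (simp add: eval3_def homogenize_def poly_sum poly_monom)

lemma le_total_degree:
  assumes "coeff (coeff P j) i \<noteq> 0"
  shows "i + j \<le> total_degree P"
proof -
  have "{i + j |i j. coeff (coeff P j) i \<noteq> 0}
      \<subseteq> (\<lambda>(j, i). i + j) ` (SIGMA j:{..degree P}. {..degree (coeff P j)})"
    by (force intro!: le_degree)
  then have "finite {i + j |i j. coeff (coeff P j) i \<noteq> 0}"
    by (rule finite_subset) auto
  then show ?thesis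
    unfolding total_degree_def using assms by (intro Max_ge) auto
qed

lemma eval3_homogenize_scale:
  "eval3 (homogenize P) (c * x, c * y, c * z)
     = c ^ total_degree P * eval3 (homogenize P) (x, y, z)"
proof -
  have "coeff (coeff P j) i * (c * x) ^ i * (c * y) ^ j * (c * z) ^ (total_degree P - (i + j))
      = c ^ total_degree P *
          (coeff (coeff P j) i * x ^ i * y ^ j * z ^ (total_degree P - (i + j)))" for i j
  proof (cases "coeff (coeff P j) i = 0")
    case False
    then have "i + j + (total_degree P - (i + j)) = total_degree P"
      using le_total_degree[of P j i] by simp
    then have "c ^ total_degree P = c ^ i * c ^ j * c ^ (total_degree P - (i + j))"
      by (simp flip: power_add)
    then show ?thesis
      by (simp add: power_mult_distrib mult_ac)
  qed simp
  then show ?thesis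
    by (simp add: eval3_homogenize sum_distrib_left)
qed

lemma eval3_homogenize_affine:
  "eval3 (homogenize P) (x, y, 1) = poly (poly P [:y:]) x"
proof -
  have "poly (poly P [:y:]) x = (\<Sum>j\<le>degree P. poly (coeff P j) x * y ^ j)"
    by (simp add: poly_altdef[of P] poly_sum)
  then show ?thesis
    by (simp add: eval3_homogenize poly_altdef sum_distrib_right)
qed

text \<open>
  If \<open>y^N\<close> is the only monomial of top degree, all other terms keep a positive power of \<open>z\<close> after
  homogenization and vanish on the line at infinity.
\<close>

lemma eval3_homogenize_infinity:
  assumes lead: "coeff (coeff P N) 0 = 1"
    and lower: "\<And>i j. coeff (coeff P j) i \<noteq> 0 \<Longrightarrow> i + j < N \<or> i = 0 \<and> j = N"
  shows "eval3 (homogenize P) (x, y, 0) = y ^ N"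
proof -
  have "N \<in> {i + j |i j. coeff (coeff P j) i \<noteq> 0}"
    using lead by (intro CollectI exI[of _ 0] exI[of _ N]) simp
  moreover have le: "m \<le> N" if "m \<in> insert 0 {i + j |i j. coeff (coeff P j) i \<noteq> 0}" for m
    using lower that by fastforce
  ultimately have td: "total_degree P = N"
    unfolding total_degree_def
    by (intro Max_eqI) (rule finite_subset[of _ "{..N}"], auto)
  have "coeff (coeff P j) i * x ^ i * y ^ j * 0 ^ (N - (i + j))
      = (if i = 0 then if j = N then y ^ N else 0 else 0)" for i j
    using lead lower[of j i] by (cases "coeff (coeff P j) i = 0") (auto simp: power_0_left)
  moreover have "N \<le> degree P"
    using lead by (intro le_degree) auto
  ultimately show ?thesis
    by (simp add: eval3_homogenize td)
qed

text \<open>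
  A point off the line \<open>z = 0\<close> has exactly one representative with \<open>z = 1\<close>, and the hypothesis
  leaves \<open>(1 : 0 : 0)\<close> as the only point of the curve on that line.
\<close>

lemma card_rational_points_one_at_infinity:
  fixes P :: "'a::{field, finite} poly poly"
  assumes infinity: "\<And>x y. eval3 (homogenize P) (x, y, 0) = 0 \<longleftrightarrow> y = 0"
  shows "card (rational_points (homogenize P)) = 1 + card {(x, y). poly (poly P [:y:]) x = 0}"
proof -
  let ?F = "homogenize P"
  let ?Z = "{(x, y). poly (poly P [:y:]) x = 0}"
  define cls :: "'a \<times> 'a \<times> 'a \<Rightarrow> _" where "cls v = proj_rel `` {v}" for v
  have cls_eq: "cls (x, y, z) = {(c * x, c * y, c * z) |c. c \<noteq> 0}" if "(x, y, z) \<noteq> (0, 0, 0)"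
    for x y z
    using that by (auto simp: cls_def proj_rel_def)
  have cls_scale: "cls (c * x, c * y, c * z) = cls (x, y, z)"
    if "c \<noteq> 0" "(x, y, z) \<noteq> (0, 0, 0)" for c x y z
  proof -
    have "((x, y, z), (c * x, c * y, c * z)) \<in> proj_rel"
      using that by (auto simp: proj_rel_def)
    then show ?thesis
      unfolding cls_def using equiv_class_eq[OF equiv_proj_rel] by blast
  qed
  have mem_iff: "cls (x, y, z) \<in> rational_points ?F \<longleftrightarrow> eval3 ?F (x, y, z) = 0"
    if nz: "(x, y, z) \<noteq> (0, 0, 0)" for x y z
  proof
    assume "cls (x, y, z) \<in> rational_points ?F"
    moreover have "(x, y, z) \<in> cls (x, y, z)"
      using nz by (auto simp: cls_eq intro!: exI[of _ 1])
    ultimately show "eval3 ?F (x, y, z) = 0"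
      by (auto simp: rational_points_def)
  next
    assume "eval3 ?F (x, y, z) = 0"
    moreover have "cls (x, y, z) \<in> proj_plane"
      unfolding proj_plane_def cls_def using nz by (intro quotientI) auto
    ultimately show "cls (x, y, z) \<in> rational_points ?F"
      using nz by (auto simp: rational_points_def cls_eq eval3_homogenize_scale)
  qed
  have "rational_points ?F = insert (cls (1, 0, 0)) ((\<lambda>(x, y). cls (x, y, 1)) ` ?Z)"
  proof (intro equalityI subsetI)
    fix Q assume Q: "Q \<in> rational_points ?F"
    then obtain x y z where xyz: "(x, y, z) \<noteq> (0, 0, 0)" "Q = cls (x, y, z)"
      by (auto simp: rational_points_def proj_plane_def cls_def elim!: quotientE)
    then have zero: "eval3 ?F (x, y, z) = 0"
      using Q mem_iff by blast
    show "Q \<in> insert (cls (1, 0, 0)) ((\<lambda>(x, y). cls (x, y, 1)) ` ?Z)"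
    proof (cases "z = 0")
      case True
      then have "y = 0"
        using zero infinity by simp
      then show ?thesis
        using True xyz cls_scale[of x 1 0 0] by simp
    next
      case False
      then have Q_eq: "Q = cls (x / z, y / z, 1)"
        using xyz cls_scale[of z "x / z" "y / z" 1] by simp
      then have "eval3 ?F (x / z, y / z, 1) = 0"
        using Q mem_iff by simp
      then have "(x / z, y / z) \<in> ?Z"
        by (simp add: eval3_homogenize_affine)
      then show ?thesis
        using Q_eq by force
    qed
  next
    fix Q assume "Q \<in> insert (cls (1, 0, 0)) ((\<lambda>(x, y). cls (x, y, 1)) ` ?Z)"
    then show "Q \<in> rational_points ?F"
      using mem_iff infinity by (auto simp: eval3_homogenize_affine)
  qed
  moreover have "cls (1, 0, 0) \<notin> (\<lambda>(x, y). cls (x, y, 1)) ` ?Z"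
  proof
    assume "cls (1, 0, 0) \<in> (\<lambda>(x, y). cls (x, y, 1)) ` ?Z"
    then obtain x y where "cls (1, 0, 0) = cls (x, y, 1)"
      by auto
    moreover have "(x, y, 1) \<in> cls (x, y, 1)"
      by (auto simp: cls_eq intro!: exI[of _ 1])
    ultimately have "(x, y, 1) \<in> cls (1, 0, 0)"
      by simp
    then show False
      by (auto simp: cls_eq)
  qed
  moreover have "inj_on (\<lambda>(x, y). cls (x, y, 1)) ?Z"
  proof (rule inj_onI, clarify)
    fix x y x' y' assume "cls (x, y, 1) = cls (x', y', 1)"
    moreover have "(x, y, 1) \<in> cls (x, y, 1)"
      by (auto simp: cls_eq intro!: exI[of _ 1])
    ultimately have "(x, y, 1) \<in> cls (x', y', 1)"
      by simp
    then show "x = x' \<and> y = y'"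
      by (auto simp: cls_eq)
  qed
  ultimately show ?thesis
    by (simp add: card_image)
qed

section \<open>Counting fibres over a finite field\<close>

text \<open>
  Summing the fibres gives \<open>card A \<le> m * card B \<le> m * n\<close>. As the two ends agree, both bounds are
  attained.
\<close>

lemma card_fibre_extremal:
  assumes fin: "finite A" "finite B" and into: "f ` A \<subseteq> B"
    and fibre: "\<And>y. y \<in> B \<Longrightarrow> card {x \<in> A. f x = y} \<le> m"
    and base: "card B \<le> n" and total: "card A = m * n" and "m > 0"
  shows "card B = n" and "y \<in> B \<Longrightarrow> card {x \<in> A. f x = y} = m"
proof -
  have "(\<Union>y\<in>B. {x \<in> A. f x = y}) = A"
    using into by auto
  moreover have "card (\<Union>y\<in>B. {x \<in> A. f x = y}) = (\<Sum>y\<in>B. card {x \<in> A. f x = y})"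
    using fin by (intro card_UN_disjoint) auto
  ultimately have card_A: "card A = (\<Sum>y\<in>B. card {x \<in> A. f x = y})"
    by simp
  also have "\<dots> \<le> m * card B"
    using sum_bounded_above[of B "\<lambda>y. card {x \<in> A. f x = y}" m] fibre by (simp add: mult.commute)
  finally have "m * n \<le> m * card B"
    using total by simp
  with base \<open>m > 0\<close> show card_B: "card B = n"
    by simp
  have "(\<Sum>y\<in>B. m - card {x \<in> A. f x = y}) = 0"
    using fibre card_A by (subst sum_subtractf_nat) (simp_all add: total card_B mult.commute)
  then show "card {x \<in> A. f x = y} = m" if "y \<in> B"
    using that fibre[OF that] fin by (auto intro: antisym)
qed

lemma card_monic_roots_le:
  fixes p :: "'a::{comm_ring_1, ring_no_zero_divisors} poly"
  assumes "degree p < n"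
  shows "card {x. x ^ n + poly p x = 0} \<le> n"
proof -
  let ?p = "monom 1 n + p"
  have "coeff ?p n = 1"
    using assms by (simp add: coeff_eq_0)
  then have "?p \<noteq> 0"
    by (metis coeff_0 zero_neq_one)
  moreover have "degree ?p \<le> n"
    using assms by (intro degree_add_le) (auto simp: degree_monom_le)
  ultimately show ?thesis
    using card_poly_roots_bound[of ?p] by (simp add: poly_monom)
qed

lemma card_power_eq_le:
  fixes y :: "'a::{comm_ring_1, ring_no_zero_divisors}"
  assumes "n > 0"
  shows "card {x. x ^ n = y} \<le> n"
  using card_monic_roots_le[of "[:-y:]" n] assms by simp

lemma power_card_minus_1_eq_1:
  fixes x :: "'a::{field, finite}"
  assumes "x \<noteq> 0"
  shows "x ^ (CARD('a) - 1) = 1"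
proof -
  have "bij_betw ((*) x) (UNIV - {0}) (UNIV - {0})"
    using assms by (intro bij_betw_byWitness[where f' = "\<lambda>y. y / x"]) auto
  then have "(\<Prod>y\<in>UNIV - {0}. x * y) = \<Prod>(UNIV - {0})"
    by (rule prod.reindex_bij_betw)
  then show ?thesis
    by (simp add: prod.distrib card_Diff_singleton)
qed

text \<open>
  The two claims are those known from the cyclic group of units, but the root bounds for \<open>x^k - y\<close>
  and \<open>y^l - 1\<close> give them without a generator: \<open>x \<mapsto> x^k\<close> maps the \<open>k * l\<close> units into the
  \<open>l\<close>-th roots of unity.
\<close>

lemma card_power_kernel:
  fixes y :: "'a::{field, finite}"
  assumes card: "CARD('a) - 1 = k * l" and k: "k > 0" and l: "l > 0"
  shows "card {y::'a. y ^ l = 1} = l"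
    and "y ^ l = 1 \<Longrightarrow> card {x. x ^ k = y} = k"
proof -
  let ?A = "UNIV - {0 :: 'a}" and ?B = "{y::'a. y ^ l = 1}"
  have "(\<lambda>x. x ^ k) ` ?A \<subseteq> ?B"
    using power_card_minus_1_eq_1[where 'a = 'a, unfolded card] by (auto simp flip: power_mult)
  moreover have fibre: "{x \<in> ?A. x ^ k = y} = {x. x ^ k = y}" if "y \<in> ?B" for y
    using that k l by (auto simp: power_0_left)
  moreover have "card ?A = k * l"
    by (simp only: card_Diff_singleton[OF UNIV_I] card)
  ultimately have *: "card ?B = l" "\<And>y. y \<in> ?B \<Longrightarrow> card {x \<in> ?A. x ^ k = y} = k"
    using card_fibre_extremal[of ?A ?B "\<lambda>x. x ^ k" k l] k l by (simp_all add: card_power_eq_le)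
  show "card ?B = l"
    by (rule *(1))
  show "card {x. x ^ k = y} = k" if "y ^ l = 1"
    using *(2)[of y] fibre[of y] that by simp
qed

section \<open>The cyclic quadratic system\<close>

text \<open>
  Suppose \<open>a \<noteq> c\<close> and put \<open>w = (b - d) / (a - c)\<close>. The differences of opposite equations are divisible
  by \<open>a - c\<close>, and the quotients are linear in \<open>a, b, c, d\<close> over the field generated by \<open>w\<close> and \<open>r\<close>.
  They express \<open>b\<close> and \<open>d\<close> through \<open>a\<close> and \<open>c\<close>, and fix \<open>s = a + c\<close> up to the factor
  \<open>D = w^2 + w - 1\<close>. Of the quadratic equations two conditions on \<open>s\<close> and \<open>m = a c\<close> remain;
  eliminating \<open>m\<close> yields \<open>w^2 r^2 D E = 0\<close> with \<open>E = w^2 - 4 w - 1\<close>.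

  If \<open>D = 0\<close>, the equation for \<open>s\<close> becomes \<open>3 w = 1\<close>, which makes the characteristic 5, and there
  the remaining conditions force \<open>r = 0\<close>. If \<open>E = 0\<close>, they force \<open>(w - 1) (a - c)^2 = 0\<close>; so
  \<open>w = 1\<close> and \<open>E = -4\<close>, the characteristic is 2, and then \<open>a - c = s = 0\<close>. Without the condition
  \<open>b \<noteq> d\<close> there is the solution \<open>a = r\<close>, \<open>b = c = d = 0\<close>.
\<close>

lemma cyclic_quadratic_system:
  fixes a b c d r :: "'a::field"
  assumes eq1: "a\<^sup>2 + b * c = r * a" and eq2: "b\<^sup>2 + c * d = r * b"
    and eq3: "c\<^sup>2 + d * a = r * c" and eq4: "d\<^sup>2 + a * b = r * d"
    and r: "r \<noteq> 0" and bd: "b \<noteq> d"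
  shows "a = c"
proof (rule ccontr)
  assume ac: "a \<noteq> c"
  define w where "w = (b - d) / (a - c)"
  have w: "w * (a - c) = b - d" and w0: "w \<noteq> 0"
    using ac bd by (auto simp: w_def)
  have "(a - c) * (b - ((1 + w) * a + c - r)) = 0"
    using eq1 eq3 w by algebra
  with ac have b: "b = (1 + w) * a + c - r"
    by simp
  have "(a - c) * (d - (a + (1 + w) * c - r)) = 0"
    using eq1 eq3 w by algebra
  with ac have d: "d = a + (1 + w) * c - r"
    by simp
  have "(a - c) * (w * (b + d - c - r) - b) = 0"
    using eq2 eq4 w by algebra
  with ac have L2: "w * (b + d - c - r) = b"
    by simp
  define s where "s = a + c"
  define m where "m = a * c"
  define t where "t = (2 + w) * s - 2 * r"
  define D where "D = w\<^sup>2 + w - 1"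
  have Ds: "D * s = r * (3 * w - 1)"
    using L2 unfolding b d s_def D_def by algebra
  have Dt: "D * t = r * (w\<^sup>2 + 3 * w)"
    using Ds unfolding t_def D_def by algebra
  have P: "(w - 1) * m = s * (r - s)"
    using eq1 unfolding b s_def m_def by algebra
  have t: "t = b + d"
    unfolding t_def s_def b d by algebra
  have bd_eq: "b * d = (1 + w) * s\<^sup>2 + w\<^sup>2 * m - r * (2 + w) * s + r\<^sup>2"
    unfolding b d s_def m_def by algebra
  \<comment> \<open>This is the analogue of \<open>P\<close> for the second equation: the Frobenius map would send \<open>w\<close> to
    \<open>- 1 / w\<close>, \<open>s\<close> to \<open>t\<close> and \<open>m\<close> to \<open>b * d\<close>.\<close>
  have "w * t * (t - r) = (w + 1) * (b * d)"
    using eq2 L2 unfolding t by algebra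
  then have Q: "w * t * (t - r) = (w + 1) * ((1 + w) * s\<^sup>2 + w\<^sup>2 * m - r * (2 + w) * s + r\<^sup>2)"
    by (simp only: bd_eq)
  show False
  proof (cases "D = 0")
    case True
    with Ds r have w3: "3 * w = 1"
      by simp
    have "9 * D = -5"
      using w3 unfolding D_def by algebra
    with True have five: "(5::'a) = 0"
      by simp
    have w2: "w = 2"
    proof -
      have "w = 2 * (3 * w) - 5 * w"
        by simp
      then show ?thesis
        by (simp only: w3 five) simp
    qed
    have "9 * r\<^sup>2 = 5 * (8 * r * s - 7 * s\<^sup>2)"
      using P Q unfolding w2 t_def by algebra
    moreover have "r\<^sup>2 = 5 * (2 * r\<^sup>2) - 9 * r\<^sup>2"
      by simp
    ultimately have "r\<^sup>2 = 0"
      by (simp only: five) simp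
    with r show False
      by simp
  next
    case False
    define E where "E = w\<^sup>2 - 4 * w - 1"
    \<comment> \<open>\<open>Q\<close> times \<open>w - 1\<close> allows \<open>m\<close> to be replaced by means of \<open>P\<close>; multiplying by \<open>D\<^sup>2\<close>
      then clears the denominators of \<open>s\<close> and \<open>t\<close>.\<close>
    have "w * (w - 1) * t * (t - r)
        = (w\<^sup>2 - 1) * ((1 + w) * s\<^sup>2 - r * (2 + w) * s + r\<^sup>2) + w\<^sup>2 * (w + 1) * (s * (r - s))"
      using Q unfolding P[symmetric] by algebra
    then have "w * (w - 1) * (D * t) * (D * t - r * D)
        = (w\<^sup>2 - 1) * ((1 + w) * (D * s)\<^sup>2 - r * (2 + w) * D * (D * s) + r\<^sup>2 * D\<^sup>2)
          + w\<^sup>2 * (w + 1) * ((D * s) * (r * D - D * s))"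
      by algebra
    then have "w\<^sup>2 * r\<^sup>2 * (D * E) = 0"
      unfolding Ds Dt unfolding D_def E_def by algebra
    with False r w0 have E0: "E = 0"
      by simp
    \<comment> \<open>\<open>(a - c)\<^sup>2 = s\<^sup>2 - 4 * m\<close> is the discriminant of the quadratic with roots \<open>a\<close> and \<open>c\<close>.\<close>
    have "D * ((w - 1) * (a - c)\<^sup>2) = s * (- r * E)"
    proof -
      have "(w - 1) * (a - c)\<^sup>2 = (w - 1) * s\<^sup>2 - 4 * ((w - 1) * m)"
        unfolding s_def m_def by algebra
      also have "\<dots> = (w - 1) * s\<^sup>2 - 4 * (s * (r - s))"
        by (simp only: P)
      finally show ?thesis
        using Ds unfolding D_def E_def by algebra
    qed
    with False E0 ac have w1: "w = 1"
      by simp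
    with E0 have "(4::'a) = 0"
      by (simp add: E_def)
    then have "(2::'a) * 2 = 0"
      by simp
    then have two: "(2::'a) = 0"
      by (metis mult_eq_0_iff)
    have "s = 2 * r"
      using Ds unfolding w1 D_def by simp
    then have "s = 0"
      by (simp add: two)
    moreover have "a - c = s - 2 * c"
      by (simp add: s_def)
    ultimately have "a - c = 0"
      by (simp add: two)
    with ac show False
      by simp
  qed
qed

section \<open>The quartic extension\<close>

locale quartic_extension =
  fixes q :: nat and K :: "'k::{field, finite} itself"
  assumes primepow_q: "primepow q" and card_K: "CARD('k) = q ^ 4"
begin

lemma q_ge_2: "q \<ge> 2"
  using primepow_gt_Suc_0[OF primepow_q] by simp

lemma frobenius_add: "(x + y :: 'k) ^ q = x ^ q + y ^ q"
proof -
  obtain p k where p: "prime p" "q = p ^ k"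
    using primepow_q unfolding primepow_def by blast
  have "prime CHAR('k)"
    by (intro prime_CHAR_semidom finite_imp_CHAR_pos) simp
  moreover have "CHAR('k) dvd q ^ 4"
  proof -
    have "bij_betw (\<lambda>x. x + 1) UNIV (UNIV :: 'k set)"
      by (rule bij_betw_byWitness[where f' = "\<lambda>x. x - 1"]) auto
    then have "(\<Sum>x\<in>UNIV. x + 1) = (\<Sum>x\<in>UNIV. x :: 'k)"
      by (rule sum.reindex_bij_betw)
    then have "of_nat CARD('k) = (0 :: 'k)"
      by (simp add: sum.distrib)
    then show ?thesis
      by (simp only: of_nat_eq_0_iff_char_dvd card_K)
  qed
  ultimately have "CHAR('k) dvd p"
    unfolding p(2) by (meson prime_dvd_power)
  then have "CHAR('k) = p"
    using \<open>prime CHAR('k)\<close> p(1) by (rule primes_dvd_imp_eq[rotated 2])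
  then show ?thesis
    using freshmans_dream'[OF \<open>prime CHAR('k)\<close>, of q k] p(2) by simp
qed

lemma frobenius_minus: "(- x :: 'k) ^ q = - (x ^ q)"
  using frobenius_add[of x "- x"] q_ge_2 by (simp add: power_0_left eq_neg_iff_add_eq_0 add.commute)

lemma frobenius_diff: "(x - y :: 'k) ^ q = x ^ q - y ^ q"
  using frobenius_add[of x "- y"] by (simp add: frobenius_minus)

lemma frobenius_square: "(x::'k) ^ q\<^sup>2 = (x ^ q) ^ q"
  by (simp add: power2_eq_square power_mult)

lemma frobenius_cube: "(x::'k) ^ q ^ 3 = ((x ^ q) ^ q) ^ q"
  by (simp add: power3_eq_cube power_mult)

lemma power_q4_minus_1:
  assumes "(x::'k) \<noteq> 0"
  shows "x ^ (q ^ 4 - 1) = 1"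
  using power_card_minus_1_eq_1[OF assms] by (simp only: card_K)

lemma frobenius_four: "((((x::'k) ^ q) ^ q) ^ q) ^ q = x"
proof (cases "x = 0")
  case False
  have "x ^ (q ^ 4) = x ^ Suc (q ^ 4 - 1)"
    using q_ge_2 by simp
  also have "\<dots> = x"
    by (simp only: power_Suc power_q4_minus_1[OF False] mult_1_right)
  finally show ?thesis
    by (simp only: power4_eq_xxxx power_mult)
qed (use q_ge_2 in \<open>simp add: power_0_left\<close>)

lemma q4_minus_1_factor: "q ^ 4 - 1 = (q - 1) * (1 + q + q\<^sup>2 + q ^ 3)"
proof -
  obtain k where "q = Suc k"
    using q_ge_2 by (cases q) auto
  then show ?thesis
    by (simp add: algebra_simps power2_eq_square power3_eq_cube power4_eq_xxxx)
qed

definition trace :: "'k \<Rightarrow> 'k" where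
  "trace y = y + y ^ q + y ^ q\<^sup>2 + y ^ q ^ 3"

lemma trace_fixed: "trace y ^ q = trace y"
  by (simp add: trace_def frobenius_add frobenius_square frobenius_cube frobenius_four)

text \<open>
  The trace polynomial has degree \<open>q^3\<close> and its values satisfy \<open>z^q = z\<close>, so the extremal principle
  applies with \<open>q^4 = q^3 * q\<close>.
\<close>

lemma card_trace_fibre:
  assumes "z ^ q = z"
  shows "card {y. trace y = z} = q ^ 3"
proof -
  let ?B = "{z::'k. z ^ q = z}"
  have "card {y. trace y = z} \<le> q ^ 3" for z
  proof -
    let ?p = "[:- z, 1:] + monom 1 q + monom 1 (q\<^sup>2) :: 'k poly"
    have "q < q\<^sup>2" "q\<^sup>2 < q ^ 3"
      using q_ge_2 by (simp_all add: power2_eq_square power3_eq_cube)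
    then have "degree ?p \<le> q\<^sup>2"
      using q_ge_2 by (intro degree_add_le) (auto intro: order.trans[OF degree_monom_le])
    then have "card {y. y ^ q ^ 3 + poly ?p y = 0} \<le> q ^ 3"
      using \<open>q\<^sup>2 < q ^ 3\<close> by (intro card_monic_roots_le) simp
    moreover have "y ^ q ^ 3 + poly ?p y = 0 \<longleftrightarrow> trace y = z" for y
      by (auto simp: trace_def poly_monom algebra_simps)
    ultimately show ?thesis
      by (simp only:)
  qed
  moreover have "card ?B \<le> q"
    using card_monic_roots_le[of "[:0, - 1 :: 'k:]" q] q_ge_2 by simp
  moreover have "card (UNIV :: 'k set) = q ^ 3 * q"
    by (simp add: card_K flip: power_Suc2)
  ultimately show ?thesis
    using card_fibre_extremal(2)[of UNIV ?B trace "q ^ 3" q z] trace_fixed q_ge_2 assms by auto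
qed

text \<open>
  The subfield is the kernel of \<open>x \<mapsto> x^(q^2) - x\<close>, whose values satisfy \<open>z^(q^2) = -z\<close>; fibres
  and image have at most \<open>q^2\<close> elements.
\<close>

lemma card_quadratic_subfield: "card {x::'k. x ^ q\<^sup>2 = x} = q\<^sup>2"
proof -
  let ?f = "\<lambda>x. x ^ q\<^sup>2 - x :: 'k" and ?B = "{z::'k. z ^ q\<^sup>2 = - z}"
  have q1: "1 < q\<^sup>2"
    using one_less_power[of q 2] q_ge_2 by simp
  have "card {x. ?f x = z} \<le> q\<^sup>2" for z
    using card_monic_roots_le[of "[:- z, - 1:]" "q\<^sup>2"] q1 by (simp add: algebra_simps)
  moreover have "card ?B \<le> q\<^sup>2"
    using card_monic_roots_le[of "[:0, 1 :: 'k:]" "q\<^sup>2"] q1 by (simp add: eq_neg_iff_add_eq_0)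
  moreover have "range ?f \<subseteq> ?B"
    by (auto simp: frobenius_square frobenius_diff frobenius_four)
  moreover have "card (UNIV :: 'k set) = q\<^sup>2 * q\<^sup>2"
    by (simp add: card_K flip: power_add)
  moreover have "(0::'k) \<in> ?B"
    using q_ge_2 by simp
  ultimately have "card {x \<in> UNIV. ?f x = 0} = q\<^sup>2"
    using q1 by (intro card_fibre_extremal(2)[of UNIV ?B ?f "q\<^sup>2" "q\<^sup>2"]) auto
  then show ?thesis
    by simp
qed

text \<open>
  This is Hilbert's Theorem 90 for the extension of degree 4 with a count of solutions: the
  hypothesis says that \<open>u\<close> has norm 1.
\<close>

lemma card_power_q_minus_1_eq:
  assumes "(u::'k) ^ (1 + q + q\<^sup>2 + q ^ 3) = 1"
  shows "card {x. x ^ (q - 1) = u} = q - 1"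
proof (rule card_power_kernel(2))
  show "CARD('k) - 1 = (q - 1) * (1 + q + q\<^sup>2 + q ^ 3)"
    by (simp only: card_K q4_minus_1_factor)
qed (use assms q_ge_2 in auto)

lemma card_fifth_roots:
  assumes "[q = 3] (mod 5)"
  shows "card {v::'k. v ^ 5 = 1 \<and> v \<noteq> 1} = 4"
proof -
  have "[q ^ 4 = 3 ^ 4] (mod 5)"
    using assms by (rule cong_pow)
  then have "5 dvd q ^ 4 - 1"
    using q_ge_2 by (subst cong_altdef_nat[symmetric]) (auto simp: cong_def)
  then have "CARD('k) - 1 = (q ^ 4 - 1) div 5 * 5"
    by (simp add: card_K)
  moreover have "q ^ 4 - 1 > 0"
    using one_less_power[of q 4] q_ge_2 by simp
  then have "(q ^ 4 - 1) div 5 > 0"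
    using \<open>5 dvd q ^ 4 - 1\<close> by (auto elim!: dvdE)
  ultimately have "card {v::'k. v ^ 5 = 1} = 5"
    by (intro card_power_kernel(1)) auto
  moreover have "{v::'k. v ^ 5 = 1 \<and> v \<noteq> 1} = {v. v ^ 5 = 1} - {1}"
    by auto
  ultimately show ?thesis
    by (simp add: card_Diff_singleton)
qed

section \<open>The values of \<open>R\<^sub>2\<close> in the base field\<close>

definition R2 :: "'k \<Rightarrow> 'k" where
  "R2 x = x + x ^ (q + q\<^sup>2 - 1)"

text \<open>
  Multiplying by \<open>x\<close> removes the negative exponent in \<open>x^(q^2 + q - 1)\<close> and leaves a quadratic form
  in the conjugates of \<open>x\<close>.
\<close>

lemma mult_R2: "x * R2 x = x\<^sup>2 + x ^ q * (x ^ q) ^ q"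
proof -
  have "x * x ^ (q + q\<^sup>2 - 1) = x ^ Suc (q + q\<^sup>2 - 1)"
    by simp
  also have "Suc (q + q\<^sup>2 - 1) = q + q\<^sup>2"
    using q_ge_2 by simp
  finally show ?thesis
    by (simp add: R2_def distrib_left power_add frobenius_square power2_eq_square[of x])
qed

lemma mult_power_q_minus_1: "(x::'k) * x ^ (q - 1) = x ^ q"
  using q_ge_2 by (simp flip: power_Suc)

lemma power_mod_5:
  assumes "(v::'k) ^ 5 = 1"
  shows "v ^ m = v ^ (m mod 5)"
proof -
  have "v ^ m = v ^ (5 * (m div 5) + m mod 5)"
    by simp
  then show ?thesis
    using assms by (simp only: power_add power_mult) simp
qed

text \<open>
  Powers of \<open>v\<close> depend only on exponents modulo 5, and distinct exponents below 5 give distinct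
  powers because 5 is prime.
\<close>

lemma cong_3_if_power_q_eq_cube:
  assumes v5: "(v::'k) ^ 5 = 1" and "v \<noteq> 1" and "v ^ q = v ^ 3"
  shows "[q = 3] (mod 5)"
proof (rule ccontr)
  assume "\<not> [q = 3] (mod 5)"
  then have "q mod 5 = 0 \<or> q mod 5 = 1 \<or> q mod 5 = 2 \<or> q mod 5 = 4"
    unfolding cong_def by fastforce
  moreover have v_mod: "v ^ (q mod 5) = v ^ 3"
    using assms power_mod_5[OF v5, of q] by simp
  ultimately have "v ^ 3 = 1 \<or> v ^ 3 = v \<or> v ^ 3 = v\<^sup>2 \<or> v ^ 3 = v ^ 4"
    by auto
  then have "v = 1"
    using v5 by (elim disjE) algebra+
  with \<open>v \<noteq> 1\<close> show False
    by simp
qed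

lemma power_q_eq_cube:
  assumes "[q = 3] (mod 5)" and "(v::'k) ^ 5 = 1"
  shows "v ^ q = v ^ 3"
  using power_mod_5[OF assms(2), of q] power_mod_5[OF assms(2), of 3] assms(1)
  by (simp add: cong_def)

text \<open>
  The elements \<open>v, v1, v2, v3\<close> stand for successive conjugates. Each is the inverse square of its
  predecessor, so their product is \<open>v^(1 - 2 + 4 - 8) = v^(-5)\<close>.
\<close>

lemma fifth_root_of_unity_if_norm_1:
  fixes v v1 v2 v3 :: "'a::field"
  assumes v1: "v1 * v\<^sup>2 = 1" and v2: "v2 * v1\<^sup>2 = 1" and v3: "v3 * v2\<^sup>2 = 1"
    and norm: "v * v1 * v2 * v3 = 1"
  shows "v ^ 5 = 1" and "v1 = v ^ 3"
proof -
  have "v2 * (v1 * v\<^sup>2)\<^sup>2 = (v2 * v1\<^sup>2) * v ^ 4"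
    by algebra
  then have v2_eq: "v2 = v ^ 4"
    by (simp only: v1 v2) simp
  have "v3 * v ^ 8 = 1"
    using v3 unfolding v2_eq by algebra
  moreover have "(v * v1 * v2 * v3) * v ^ 10 = v ^ 5 * (v1 * v\<^sup>2) * (v3 * v ^ 8)"
    unfolding v2_eq by algebra
  ultimately have "v ^ 10 = v ^ 5"
    by (simp add: norm v1)
  moreover have "v \<noteq> 0"
    using v1 by auto
  ultimately show v5: "v ^ 5 = 1"
    using power_add[of v 5 5] by (metis mult_cancel_left2 numeral_Bit0 power_not_zero)
  have "v1 * v ^ 5 = (v1 * v\<^sup>2) * v ^ 3"
    by algebra
  then show "v1 = v ^ 3"
    by (simp add: v1 v5)
qed

text \<open>
  From \<open>x^q = - v x\<close> one gets \<open>x * R2 x = x^2 * (1 - v^q * v^2)\<close>. The conjugates of the equation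
  \<open>v^q * v^2 = 1\<close> and the norm of \<open>-v\<close> then determine \<open>v\<close> as a fifth root of unity.
\<close>

lemma R2_eq_0_iff:
  assumes x: "x \<noteq> 0" and v: "x ^ (q - 1) = - v"
  shows "R2 x = 0 \<longleftrightarrow> v ^ 5 = 1 \<and> v ^ q = v ^ 3"
proof -
  have x1: "x ^ q = - v * x"
    using mult_power_q_minus_1[of x] v by (simp add: mult.commute)
  have x2: "(x ^ q) ^ q = - (v ^ q) * x ^ q"
    by (subst x1) (simp add: power_mult_distrib frobenius_minus)
  have "x * R2 x = x\<^sup>2 * (1 - v ^ q * v\<^sup>2)"
    unfolding mult_R2 x2 unfolding x1 by algebra
  with x have R2_iff: "R2 x = 0 \<longleftrightarrow> v ^ q * v\<^sup>2 = 1"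
    by auto
  show ?thesis
  proof
    assume "R2 x = 0"
    then have v1: "v ^ q * v\<^sup>2 = 1"
      by (simp add: R2_iff)
    have v2: "(v ^ q) ^ q * (v ^ q)\<^sup>2 = 1"
      using arg_cong[OF v1, of "\<lambda>t. t ^ q"] by (simp add: power_mult_distrib power2_eq_square)
    have v3: "((v ^ q) ^ q) ^ q * ((v ^ q) ^ q)\<^sup>2 = 1"
      using arg_cong[OF v2, of "\<lambda>t. t ^ q"] by (simp add: power_mult_distrib power2_eq_square)
    have x3: "((x ^ q) ^ q) ^ q = - ((v ^ q) ^ q) * (x ^ q) ^ q"
      by (subst x2) (simp add: power_mult_distrib frobenius_minus)
    have "(((x ^ q) ^ q) ^ q) ^ q = - (((v ^ q) ^ q) ^ q) * ((x ^ q) ^ q) ^ q"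
      by (subst x3) (simp add: power_mult_distrib frobenius_minus)
    \<comment> \<open>The fourth Frobenius power is the identity, so \<open>- v\<close>, and with it \<open>v\<close>, has norm 1.\<close>
    then have "x * (v * v ^ q * (v ^ q) ^ q * ((v ^ q) ^ q) ^ q) = x"
      unfolding frobenius_four unfolding x3 unfolding x2 unfolding x1 by (simp add: mult_ac)
    with x have norm: "v * v ^ q * (v ^ q) ^ q * ((v ^ q) ^ q) ^ q = 1"
      by simp
    show "v ^ 5 = 1 \<and> v ^ q = v ^ 3"
      using fifth_root_of_unity_if_norm_1[OF v1 v2 v3 norm] by simp
  next
    assume "v ^ 5 = 1 \<and> v ^ q = v ^ 3"
    then show "R2 x = 0"
      by (simp add: R2_iff flip: power_add)
  qed
qed

text \<open>
  A nonzero value of \<open>R2\<close> in the base field makes the conjugates of \<open>x\<close> a solution of the cyclic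
  system; a zero value is governed by the fifth roots of unity, among which \<open>v = 1\<close> belongs to
  \<open>x^q = -x\<close> and hence to the quadratic subfield.
\<close>

lemma R2_fixed_iff:
  "R2 x ^ q = R2 x \<longleftrightarrow>
     x ^ q\<^sup>2 = x \<or> [q = 3] (mod 5) \<and> (\<exists>v. v ^ 5 = 1 \<and> v \<noteq> 1 \<and> x ^ (q - 1) = - v)"
    (is "?L \<longleftrightarrow> ?quad \<or> ?root")
proof (cases "x = 0")
  case True
  have "q + q\<^sup>2 - 1 > 0"
    using q_ge_2 by simp
  with True show ?thesis
    using q_ge_2 by (simp add: R2_def power_0_left)
next
  case x: False
  show ?thesis
  proof
    assume fixed: ?L
    show "?quad \<or> ?root"
    proof (cases "R2 x = 0")
      case True
      define v where "v = - (x ^ (q - 1))"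
      have v: "v ^ 5 = 1" "v ^ q = v ^ 3"
        using R2_eq_0_iff[OF x, of v] True by (auto simp: v_def)
      show ?thesis
      proof (cases "v = 1")
        case True
        then have "x ^ (q - 1) = - 1"
          unfolding v_def by (simp add: minus_equation_iff)
        then have "x ^ q = - x"
          using mult_power_q_minus_1[of x] by simp
        then show ?thesis
          by (simp add: frobenius_square frobenius_minus)
      next
        case False
        then show ?thesis
          using v cong_3_if_power_q_eq_cube[of v] by (auto simp: v_def intro!: exI[of _ v])
      qed
    next
      case False
      define r where "r = R2 x"
      have r: "r ^ q = r" "r \<noteq> 0"
        using fixed False by (simp_all add: r_def)
      have step: "(t ^ q)\<^sup>2 + u ^ q * w ^ q = r * t ^ q" if "t\<^sup>2 + u * w = r * t" for t u w
        using arg_cong[OF that, of "\<lambda>t. t ^ q"] r(1)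
        by (simp add: power_mult_distrib frobenius_add power2_eq_square)
      have eq1: "x\<^sup>2 + x ^ q * (x ^ q) ^ q = r * x"
        using mult_R2[of x] by (simp add: r_def mult.commute)
      note eq2 = step[OF eq1]
      note eq3 = step[OF eq2]
      note eq4 = step[OF eq3]
      have "x = (x ^ q) ^ q"
      proof (cases "x ^ q = ((x ^ q) ^ q) ^ q")
        case True
        \<comment> \<open>Apply the Frobenius map three more times to \<open>b = d\<close>.\<close>
        then have "((x ^ q) ^ q) ^ q = ((((x ^ q) ^ q) ^ q) ^ q) ^ q"
          by simp
        then have "(((x ^ q) ^ q) ^ q) ^ q = (((((x ^ q) ^ q) ^ q) ^ q) ^ q) ^ q"
          by (rule arg_cong)
        then show ?thesis
          by (simp only: frobenius_four)
      next
        case False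
        then show ?thesis
          using cyclic_quadratic_system[OF eq1 eq2 _ _ r(2) False] eq3 eq4
          by (simp only: frobenius_four)
      qed
      then show ?thesis
        by (simp add: frobenius_square)
    qed
  next
    assume "?quad \<or> ?root"
    then show ?L
    proof
      assume ?quad
      then have x2: "(x ^ q) ^ q = x"
        by (simp add: frobenius_square)
      have "x * R2 x = x * (x + x ^ q)"
        unfolding mult_R2 x2 by algebra
      with x have "R2 x = x + x ^ q"
        by simp
      then show ?L
        by (simp add: frobenius_add x2)
    next
      assume ?root
      then have "R2 x = 0"
        using R2_eq_0_iff[OF x] power_q_eq_cube by blast
      then show ?L
        using q_ge_2 by simp
    qed
  qed
qed

text \<open>
  If \<open>q\<close> is 3 modulo 5, a nontrivial fifth root of unity \<open>v\<close> has the conjugates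
  \<open>v, v^3, v^4, v^2\<close>. Hence \<open>-v\<close> has norm \<open>v^10 = 1\<close>, so \<open>x^(q - 1) = -v\<close> is solvable, and its
  solutions satisfy \<open>x^(q^2) = v^4 x\<close>, so they lie outside the quadratic subfield.
\<close>

lemma card_R2_fixed:
  "card {x. R2 x ^ q = R2 x} = (if [q = 3] (mod 5) then q\<^sup>2 + 4 * (q - 1) else q\<^sup>2)"
proof (cases "[q = 3] (mod 5)")
  case False
  then show ?thesis
    by (simp add: R2_fixed_iff card_quadratic_subfield)
next
  case q3: True
  define V where "V = {v::'k. v ^ 5 = 1 \<and> v \<noteq> 1}"
  define X where "X v = {x::'k. x ^ (q - 1) = - v}" for v
  have split: "{x. R2 x ^ q = R2 x} = {x. x ^ q\<^sup>2 = x} \<union> (\<Union>v\<in>V. X v)"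
    using q3 by (auto simp: R2_fixed_iff V_def X_def)
  have "card (X v) = q - 1" if "v \<in> V" for v
  proof -
    have v5: "v ^ 5 = 1"
      using that by (simp add: V_def)
    have v1: "v ^ q = v ^ 3"
      using q3 v5 by (rule power_q_eq_cube)
    have v2: "(v ^ 3) ^ q = v ^ 9"
      using arg_cong[OF v1, of "\<lambda>t. t ^ 3"] by (simp add: mult.commute flip: power_mult)
    have v3: "(v ^ 9) ^ q = v ^ 27"
      using arg_cong[OF v1, of "\<lambda>t. t ^ 9"] by (simp add: mult.commute flip: power_mult)
    have "(- v) ^ (1 + q + q\<^sup>2 + q ^ 3) = v * v ^ q * (v ^ q) ^ q * ((v ^ q) ^ q) ^ q"
      by (simp only: power_add frobenius_square frobenius_cube frobenius_minus) simp
    also have "\<dots> = v * v ^ 3 * v ^ 9 * v ^ 27"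
      by (simp only: v1 v2 v3)
    also have "\<dots> = (v ^ 5) ^ 8"
      by (simp flip: power_add power_mult power_Suc)
    finally show ?thesis
      unfolding X_def by (intro card_power_q_minus_1_eq) (simp add: v5)
  qed
  moreover have "X v \<inter> X w = {}" if "v \<noteq> w" for v w
    using that by (auto simp: X_def)
  ultimately have "card (\<Union>v\<in>V. X v) = card V * (q - 1)"
    by (subst card_UN_disjoint) auto
  moreover have "{x. x ^ q\<^sup>2 = x} \<inter> (\<Union>v\<in>V. X v) = {}"
  proof -
    have False if v: "v \<in> V" and x: "x \<in> X v" and quad: "x ^ q\<^sup>2 = x" for v x
    proof -
      have v5: "v ^ 5 = 1" and "v \<noteq> 1"
        using v by (simp_all add: V_def)
      have "x \<noteq> 0"
        using x v5 q_ge_2 by (auto simp: X_def power_0_left)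
      have x1: "x ^ q = - v * x"
        using mult_power_q_minus_1[of x] x by (simp add: X_def mult.commute)
      have "(x ^ q) ^ q = - (v ^ 3) * x ^ q"
        by (subst x1) (simp add: power_mult_distrib frobenius_minus power_q_eq_cube[OF q3 v5])
      then have "x = - (v ^ 3) * (- v * x)"
        using quad by (simp only: frobenius_square x1[symmetric])
      then have "x * v ^ 4 = x * 1"
        by algebra
      with \<open>x \<noteq> 0\<close> have "v ^ 4 = 1"
        by simp
      then have "v = 1"
        using v5 by algebra
      with \<open>v \<noteq> 1\<close> show False
        by simp
    qed
    then show ?thesis
      by blast
  qed
  ultimately show ?thesis
    using q3 card_fifth_roots[OF q3]
    by (simp add: split card_Un_disjoint card_quadratic_subfield V_def)
qed

section \<open>The curve\<close>

lemma poly_affine_eqn: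
  "poly (poly (affine_eqn q 4 2) [:y:]) x = trace y - R2 x"
proof -
  have "{..<4} = {0, 1, 2, 3::nat}"
    by auto
  then show ?thesis
    by (simp add: affine_eqn_def R_poly_def poly_sum poly_monom trace_def R2_def add.assoc)
qed

lemma card_affine_points:
  "card {(x, y). trace y = R2 x} = q ^ 3 * card {x. R2 x ^ q = R2 x}"
proof -
  have "{(x, y). trace y = R2 x}
      = (SIGMA x:{x. R2 x ^ q = R2 x}. {y. trace y = R2 x})"
  proof (intro equalityI subsetI)
    fix z assume "z \<in> {(x, y). trace y = R2 x}"
    then show "z \<in> (SIGMA x:{x. R2 x ^ q = R2 x}. {y. trace y = R2 x})"
      using trace_fixed[of "snd z"] by auto
  qed auto
  then have "card {(x, y). trace y = R2 x}
      = (\<Sum>x\<in>{x. R2 x ^ q = R2 x}. card {y. trace y = R2 x})"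
    by simp
  then show ?thesis
    by (simp add: card_trace_fibre)
qed

lemma eval3_curve_infinity:
  "eval3 (curve_C q 4 2) (x :: 'k, y, 0) = y ^ q ^ 3"
  unfolding curve_C_def
proof (rule eval3_homogenize_infinity)
  have q1: "1 < q" "q < q\<^sup>2" "q\<^sup>2 < q ^ 3"
    using q_ge_2 power_strict_increasing[of 1 2 q] power_strict_increasing[of 2 3 q] by simp_all
  have "2 * q\<^sup>2 \<le> q ^ 3"
    using q_ge_2 by (simp add: power2_eq_square power3_eq_cube)
  then have deg: "q + q\<^sup>2 - 1 < q ^ 3"
    using q1 power_Suc[of q 2] by linarith
  have c: "coeff (affine_eqn q 4 2 :: 'k poly poly) j =
      (if j = 0 then - R_poly q 2 else if j \<in> {1, q, q\<^sup>2, q ^ 3} then 1 else 0)" for j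
  proof -
    have "{..<4} = {0, 1, 2, 3::nat}"
      by auto
    then have "affine_eqn q 4 2 = monom 1 1 + monom 1 q + monom 1 (q\<^sup>2) + monom 1 (q ^ 3)
        - [:R_poly q 2 :: 'k poly:]"
      by (simp add: affine_eqn_def add.assoc)
    moreover have "coeff (monom 1 1 + monom 1 k + monom 1 l + monom 1 m - [:R :: 'k poly:]) j =
        (if j = 0 then - R else if j \<in> {1, k, l, m} then 1 else 0)"
      if "1 < k" "k < l" "l < m" for k l m R
      using that by (cases j) auto
    ultimately show ?thesis
      using q1 by (simp only:)
  qed
  show "coeff (coeff (affine_eqn q 4 2 :: 'k poly poly) (q ^ 3)) 0 = 1"
    using q1 by (simp add: c)
  fix i j
  assume "coeff (coeff (affine_eqn q 4 2 :: 'k poly poly) j) i \<noteq> 0"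
  then show "i + j < q ^ 3 \<or> i = 0 \<and> j = q ^ 3"
    using q1 deg by (auto simp: c R_poly_def split: if_splits)
qed

end

theorem corollary16:
  fixes q n d :: nat
  assumes "primepow q" and "d = 2" and "n = 4"
    and "CARD('k) = q ^ n"
  shows "card (rational_points (curve_C q n d :: 'k::{field, finite} poly poly poly)) =
    (if [q = 3] (mod 5)
     then 1 + q ^ (n - 1 + d) + 4 * (q - 1) * q ^ (n - 1)
     else 1 + q ^ (n - 1 + d))"
proof -
  interpret quartic_extension q "TYPE('k)"
    using assms by unfold_locales simp_all
  have "card (rational_points (curve_C q 4 2 :: 'k poly poly poly))
      = 1 + q ^ 3 * card {x. R2 x ^ q = R2 x}"
    using card_rational_points_one_at_infinity[of "affine_eqn q 4 2 :: 'k poly poly"] 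
      eval3_curve_infinity q_ge_2
    by (simp add: curve_C_def poly_affine_eqn card_affine_points)
  then show ?thesis
    using assms by (simp add: card_R2_fixed algebra_simps flip: power_add)
qed

end
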